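(* Let $\mathbb{U}$ be a convex subset of a Euclidean space and consider an irreducible positive linear system $\dot x = A(u)x$, $x(0)=x_0$, $y = cx$, where, for each $u\in\mathbb{U}$, $A(u)\in\mathbb{R}^{n\times n}$ is an irreducible Metzler matrix, and $c=(c_1,\ldots,c_n)$ is a row vector with all entries strictly positive. Then for every $u\in\mathbb{U}$ and every initial state $x_0$ with all coordinates strictly positive, the logarithmic rate $\rho(u,x_0)$ equals the Frobenius eigenvalue of $A(u)$: $$\rho(u,x_0)=\limsup_{t\to+\infty}\frac1t\ln|y(t,u,x_0)| = \lambda_F(u).$$ In particular the rate does not depend on $x_0$, and one writes $\rho(u)=\lambda_F(u)$.
   Context: The parameter $u$ is constant in time. For $u\in\mathbb{U}$ and $x_0\in\mathbb{R}^n$ with strictly positive coordinates, $x(t,u,x_0)$ denotes the solution at time $t\ge 0$ of $\dot x=A(u)x$, $x(0)=x_0$, and $y(t,u,x_0)=c\,x(t,u,x_0)$ is the output. Logarithmic rate: $\rho(u,x_0):=\limsup_{t\to+\infty}\frac1t\ln|y(t,u,x_0)|$ (with the logarithm read as $-\infty$ when $y(t,u,x_0)=0$). When it is independent of $x_0$ it is written $\rho(u)$. Metzler matrix: a real square matrix whose off-diagonal entries are all nonnegative (diagonal entries are arbitrary real numbers). Irreducible (the paper's definition, for a Metzler matrix $A$): for some $r\in\mathbb{R}$ and some positive integer $k$, the matrix $(rI+A)^k$ has all entries strictly positive. Frobenius eigenvalue: for an irreducible Metzler matrix $A$, it is known that there is a real eigenvalue $\lambda_F$ of $A$, of algebraic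 multiplicity one, such that every other eigenvalue has real part strictly less than $\lambda_F$; this is the Frobenius eigenvalue. $\lambda_F(u)$ denotes the Frobenius eigenvalue of $A(u)$. *)

theory Defs
  imports "HOL-Analysis.Analysis" "HOL-Computational_Algebra.Polynomial"
begin

definition metzler :: "real^'n^'n \<Rightarrow> bool" where
  "metzler A \<longleftrightarrow> (\<forall>i j. i \<noteq> j \<longrightarrow> 0 \<le> A $ i $ j)"

text \<open>Multiplication and powers on the type \<open>'a^'n^'n\<close> are componentwise, hence a separate
  power for the matrix product.\<close>

primrec matrix_power :: "'a::semiring_1^'n^'n \<Rightarrow> nat \<Rightarrow> 'a^'n^'n" where
  "matrix_power M 0 = mat 1"
| "matrix_power M (Suc k) = M ** matrix_power M k"

definition irreducible_metzler :: "real^'n^'n \<Rightarrow> bool" where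
  "irreducible_metzler A \<longleftrightarrow>
     metzler A \<and> (\<exists>r::real. \<exists>k>0. \<forall>i j. 0 < matrix_power (r *\<^sub>R mat 1 + A) k $ i $ j)"

definition complex_matrix :: "real^'n^'m \<Rightarrow> complex^'n^'m" where
  "complex_matrix A = map_matrix complex_of_real A"

definition eigenvalue :: "'a::field^'n^'n \<Rightarrow> 'a \<Rightarrow> bool" where
  "eigenvalue M \<mu> \<longleftrightarrow> (\<exists>v. v \<noteq> 0 \<and> M *v v = \<mu> *s v)"

definition charpoly :: "'a::comm_ring_1^'n^'n \<Rightarrow> 'a poly" where
  "charpoly M = det (mat [:0, 1:] - map_matrix (\<lambda>a. [:a:]) M)"

definition algebraic_multiplicity :: "'a::field^'n^'n \<Rightarrow> 'a \<Rightarrow> nat" where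
  "algebraic_multiplicity M \<mu> = order \<mu> (charpoly M)"

definition is_frobenius_eigenvalue :: "real^'n^'n \<Rightarrow> real \<Rightarrow> bool" where
  "is_frobenius_eigenvalue A l \<longleftrightarrow>
     eigenvalue (complex_matrix A) (of_real l) \<and>
     algebraic_multiplicity (complex_matrix A) (of_real l) = 1 \<and>
     (\<forall>\<mu>. eigenvalue (complex_matrix A) \<mu> \<and> \<mu> \<noteq> of_real l \<longrightarrow> Re \<mu> < l)"

definition frobenius_eigenvalue :: "real^'n^'n \<Rightarrow> real" where
  "frobenius_eigenvalue A = (THE l. is_frobenius_eigenvalue A l)"

definition positive_vec :: "real^'n \<Rightarrow> bool" where
  "positive_vec v \<longleftrightarrow> (\<forall>i. 0 < v $ i)"

definition is_solution :: "real^'n^'n \<Rightarrow> real^'n \<Rightarrow> (real \<Rightarrow> real^'n) \<Rightarrow> bool" where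
  "is_solution A x0 x \<longleftrightarrow> x 0 = x0 \<and>
     (\<forall>t\<ge>0. (x has_vector_derivative A *v x t) (at t within {0..}))"

text \<open>Solutions are constrained on \<open>t \<ge> 0\<close> only, so it is the value at time \<open>t\<close>, not the
  function on the whole real line, that is unique; it is meaningful for \<open>t \<ge> 0\<close>.\<close>

definition trajectory :: "real^'n^'n \<Rightarrow> real^'n \<Rightarrow> real \<Rightarrow> real^'n" where
  "trajectory A x0 t = (THE z. \<exists>x. is_solution A x0 x \<and> x t = z)"

text \<open>The row vector \<open>c\<close> is a vector, and the product \<open>c x\<close> is the inner product.\<close>

definition system_output :: "real^'n^'n \<Rightarrow> real^'n \<Rightarrow> real^'n \<Rightarrow> real \<Rightarrow> real" where
  "system_output A c x0 t = c \<bullet> trajectory A x0 t"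

text \<open>In HOL \<open>ln 0 = 0\<close>; here the logarithm of \<open>0\<close> is minus infinity.\<close>

definition ln_abs :: "real \<Rightarrow> ereal" where
  "ln_abs y = (if y = 0 then -\<infinity> else ereal (ln \<bar>y\<bar>))"

definition log_rate :: "real^'n^'n \<Rightarrow> real^'n \<Rightarrow> real^'n \<Rightarrow> ereal" where
  "log_rate A c x0 = Limsup at_top (\<lambda>t::real. ereal (1 / t) * ln_abs (system_output A c x0 t))"

text \<open>The common value of the rate over all positive initial states, when there is one.\<close>

definition common_log_rate :: "real^'n^'n \<Rightarrow> real^'n \<Rightarrow> ereal" where
  "common_log_rate A c = (THE r. \<forall>x0. positive_vec x0 \<longrightarrow> log_rate A c x0 = r)"

end

theory Submission
  imports Defs
begin

text \<open>Let \<open>v\<close> and \<open>w\<close> be positive right and left eigenvectors of \<open>A\<close>; pairing them shows that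
  they share their eigenvalue \<open>l\<close>, and \<open>l\<close> turns out to be the Frobenius eigenvalue. Along a
  solution \<open>w \<bullet> x t = exp (l t) (w \<bullet> x0)\<close> exactly, and since \<open>x t\<close> stays nonnegative, the
  output \<open>c \<bullet> x t\<close> lies between two positive multiples of \<open>w \<bullet> x t\<close>.\<close>

section \<open>Perron--Frobenius theory\<close>

text \<open>Strong connectivity of the digraph of nonzero entries, phrased by cuts: an edge leaves
  every proper nonempty index set. Cuts are what the zero set of a vector produces, and they never
  see the diagonal.\<close>

definition strongly_connected :: "real^'n^'n \<Rightarrow> bool" where
  "strongly_connected A \<longleftrightarrow>
     (\<forall>S. S \<noteq> {} \<and> S \<noteq> UNIV \<longrightarrow> (\<exists>i\<in>S. \<exists>j\<in>-S. A $ i $ j \<noteq> 0))"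

lemma strongly_connected_transpose:
  assumes "strongly_connected A"
  shows "strongly_connected (transpose A)"
  unfolding strongly_connected_def
proof (intro allI impI)
  fix S :: "'a set"
  assume "S \<noteq> {} \<and> S \<noteq> UNIV"
  then have "-S \<noteq> {} \<and> -S \<noteq> UNIV" by auto
  with assms obtain i j where "i \<in> -S" "j \<in> S" "A $ i $ j \<noteq> 0"
    unfolding strongly_connected_def by (metis double_complement)
  then show "\<exists>i\<in>S. \<exists>j\<in>-S. transpose A $ i $ j \<noteq> 0"
    by (intro bexI[of _ j] bexI[of _ i]) (simp_all add: transpose_def)
qed

lemma metzler_transpose: "metzler A \<Longrightarrow> metzler (transpose A)"
  by (auto simp: metzler_def transpose_def)

text \<open>A walk that starts in \<open>S\<close> can never leave it, so no power acquires an entry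
  in the block.\<close>

lemma matrix_power_block_zero:
  assumes "\<And>i j. i \<in> S \<Longrightarrow> j \<notin> S \<Longrightarrow> M $ i $ j = 0"
  shows "i \<in> S \<Longrightarrow> j \<notin> S \<Longrightarrow> matrix_power M k $ i $ j = 0"
proof (induction k arbitrary: i)
  case 0
  then show ?case by (auto simp: mat_def)
next
  case (Suc k)
  have "M $ i $ l * matrix_power M k $ l $ j = 0" for l
    using assms[of i l] Suc by (cases "l \<in> S") auto
  then show ?case by (simp add: matrix_matrix_mult_def)
qed

lemma irreducible_metzler_strongly_connected:
  assumes "irreducible_metzler A"
  shows "strongly_connected A"
  unfolding strongly_connected_def
proof (intro allI impI, rule ccontr)
  fix S :: "'a set"
  assume S: "S \<noteq> {} \<and> S \<noteq> UNIV" and neg: "\<not> (\<exists>i\<in>S. \<exists>j\<in>-S. A $ i $ j \<noteq> 0)"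
  obtain r :: real and k where pos: "\<And>i j. 0 < matrix_power (r *\<^sub>R mat 1 + A) k $ i $ j"
    using assms unfolding irreducible_metzler_def by blast
  obtain i j where ij: "i \<in> S" "j \<notin> S" using S by blast
  \<comment> \<open>The shift by \<open>r\<close> changes only the diagonal, so the cut block of the
    shifted matrix vanishes as well.\<close>
  have "matrix_power (r *\<^sub>R mat 1 + A) k $ i $ j = 0"
    by (rule matrix_power_block_zero[OF _ ij]) (use neg in \<open>auto simp: mat_def\<close>)
  with pos[of i j] show False by simp
qed

text \<open>Adding \<open>s I\<close> keeps eigenvectors and translates eigenvalues by
  \<open>s\<close>, so arguments for nonnegative matrices become available for Metzler ones.\<close>

lemma metzler_shift_nonneg:
  fixes A :: "real^'n^'n"
  assumes "metzler A"
  shows "\<exists>s. (\<forall>i j. 0 \<le> (mat s + A) $ i $ j) \<and> (\<forall>i. 0 < (mat s + A) $ i $ i)"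
proof -
  \<comment> \<open>The sum dominates every diagonal entry in absolute value; the extra 1 makes the
    shifted diagonal strictly positive.\<close>
  define s where "s = 1 + (\<Sum>i\<in>UNIV. \<bar>A $ i $ i\<bar>)"
  have "\<bar>A $ i $ i\<bar> < s" for i
    using member_le_sum[of i UNIV "\<lambda>i. \<bar>A $ i $ i\<bar>"] unfolding s_def by simp
  then have diag: "0 < s + A $ i $ i" for i
    by (smt (verit))
  have "0 \<le> (mat s + A) $ i $ j" for i j
    using assms diag[of i] by (cases "i = j") (auto simp: mat_def metzler_def)
  moreover have "0 < (mat s + A) $ i $ i" for i
    using diag[of i] by (simp add: mat_def)
  ultimately show ?thesis by blast
qed

lemma mat_mult_vec: "mat s *v x = s *s (x :: 'a::comm_semiring_1^'n)"
proof -
  have "(\<Sum>j\<in>UNIV. (if i = j then s else 0) * x $ j) = s * x $ i" for i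
    by (subst sum.cong[OF refl, of UNIV _ "\<lambda>j. if i = j then s * x $ j else 0"]) auto
  then show ?thesis
    by (simp add: vec_eq_iff matrix_vector_mult_def mat_def)
qed

section \<open>Positive right and left eigenvectors\<close>

text \<open>On a row where \<open>x\<close> vanishes, the eigenvector equation is a vanishing sum of
  nonnegative terms. An edge leaving the zero set would contribute a nonzero term.\<close>

lemma nonneg_eigenvector_positive:
  fixes A :: "real^'n^'n"
  assumes "metzler A" "strongly_connected A"
    and eig: "A *v x = l *s x" and nonneg: "\<And>i. 0 \<le> x $ i" and "x \<noteq> 0"
  shows "positive_vec x"
proof -
  define S where "S = {i. x $ i = 0}"
  have "S \<noteq> UNIV" using \<open>x \<noteq> 0\<close> by (auto simp: S_def vec_eq_iff)
  have "S = {}"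
  proof (rule ccontr)
    assume "S \<noteq> {}"
    with \<open>S \<noteq> UNIV\<close> assms(2) obtain i j where ij: "i \<in> S" "j \<notin> S" "A $ i $ j \<noteq> 0"
      unfolding strongly_connected_def by (metis ComplD)
    \<comment> \<open>The diagonal entry may be negative, but it is multiplied by
      \<open>x $ i = 0\<close>.\<close>
    have terms: "0 \<le> A $ i $ m * x $ m" for m
      using ij(1) nonneg[of m] assms(1) by (cases "m = i") (auto simp: S_def metzler_def)
    have "(\<Sum>m\<in>UNIV. A $ i $ m * x $ m) = l * x $ i"
      using arg_cong[OF eig, of "\<lambda>v. v $ i"] by (simp add: matrix_vector_mult_def)
    also have "\<dots> = 0" using ij(1) by (simp add: S_def)
    finally have "A $ i $ j * x $ j = 0"
      using terms by (simp add: sum_nonneg_eq_0_iff)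
    with ij show False by (auto simp: S_def)
  qed
  then show ?thesis
    using nonneg unfolding positive_vec_def S_def by (metis (mono_tags, lifting) empty_Collect_eq less_eq_real_def)
qed

text \<open>Brouwer's theorem on the standard simplex, for the normalized action of a nonnegative shift
  of \<open>A\<close> with positive diagonal.\<close>

lemma perron_eigenvector_exists:
  fixes A :: "real^'n^'n"
  assumes "metzler A" "strongly_connected A"
  obtains v l where "positive_vec v" "A *v v = l *s v"
proof -
  obtain s where nn: "\<And>i j. 0 \<le> (mat s + A) $ i $ j" and diag: "\<And>i. 0 < (mat s + A) $ i $ i"
    using metzler_shift_nonneg[OF assms(1)] by blast
  define B where "B = mat s + A"
  define T where "T x = (\<Sum>i\<in>UNIV. x $ i)" for x :: "real^'n"
  define S where "S = {x :: real^'n. (\<forall>i. 0 \<le> x $ i) \<and> T x = 1}"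
  have Tlin: "bounded_linear T"
    unfolding T_def by (intro bounded_linear_sum bounded_linear_vec_nth)
  have Tscale: "T (a *\<^sub>R x) = a * T x" for a x
    by (simp add: T_def sum_distrib_left)
  have nonneg: "0 \<le> (B *v x) $ i" if "x \<in> S" for x i
    using that nn by (auto simp: matrix_vector_mult_def S_def B_def intro!: sum_nonneg)
  \<comment> \<open>The positive diagonal prevents \<open>B\<close> from annihilating a point of the
    simplex, so dividing by the coordinate sum is legitimate.\<close>
  have Tpos: "0 < T (B *v x)" if "x \<in> S" for x
  proof -
    have "x \<noteq> 0" using that by (auto simp: S_def T_def)
    then obtain i where "x $ i \<noteq> 0" by (auto simp: vec_eq_iff)
    then have "0 < B $ i $ i * x $ i"
      using that diag[of i] by (simp add: S_def B_def less_le)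
    also have "\<dots> \<le> (B *v x) $ i"
      unfolding matrix_vector_mult_def using that nn
      by (simp add: S_def B_def member_le_sum[of i UNIV "\<lambda>j. (mat s + A) $ i $ j * x $ j", simplified])
    also have "\<dots> \<le> T (B *v x)"
      unfolding T_def using nonneg[OF that] by (intro member_le_sum) auto
    finally show ?thesis .
  qed
  have "closed S"
  proof -
    have "S = {x. \<forall>i. 0 \<le> x $ i} \<inter> {x. T x = 1}" by (auto simp: S_def)
    moreover have "continuous_on UNIV T"
      by (rule linear_continuous_on[OF Tlin])
    ultimately show ?thesis
      by (auto intro!: closed_Int closed_positive_orthant closed_Collect_eq continuous_intros)
  qed
  moreover have "bounded S"
  proof -
    have "norm x \<le> 1" if "x \<in> S" for x
      using norm_le_l1_cart[of x] that by (simp add: S_def T_def)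
    then show ?thesis by (auto simp: bounded_iff)
  qed
  ultimately have "compact S" by (simp add: compact_eq_bounded_closed)
  moreover have "convex S"
    unfolding convex_def S_def
    by (auto simp: linear_add[OF bounded_linear.linear[OF Tlin]] Tscale)
  moreover have "axis k 1 \<in> S" for k
    by (simp add: S_def T_def axis_def)
  then have "S \<noteq> {}" by blast
  moreover have "continuous_on S (\<lambda>x. (1 / T (B *v x)) *\<^sub>R (B *v x))"
  proof -
    have B: "continuous_on S (\<lambda>x. B *v x)"
      by (intro linear_continuous_on matrix_vector_mul_bounded_linear)
    then have "continuous_on S (\<lambda>x. T (B *v x))"
      using bounded_linear.continuous_on[OF Tlin] by blast
    with B show ?thesis
      using Tpos by (intro continuous_intros) (auto simp: less_imp_neq[symmetric])
  qed
  moreover have "(\<lambda>x. (1 / T (B *v x)) *\<^sub>R (B *v x)) \<in> S \<rightarrow> S"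
    using nonneg Tpos by (auto simp: S_def Tscale less_imp_le less_imp_neq[symmetric] intro!: divide_nonneg_pos)
  ultimately obtain x where x: "x \<in> S" "(1 / T (B *v x)) *\<^sub>R (B *v x) = x"
    by (rule brouwer)
  \<comment> \<open>The normalizing factor at the fixed point is an eigenvalue of \<open>B\<close>;
    undoing the shift subtracts \<open>s\<close>.\<close>
  from x(2) have "T (B *v x) *s x = B *v x"
    using Tpos[OF x(1)]
    by (metis divideR_right scalar_mult_eq_scaleR inverse_eq_divide less_irrefl)
  then have eig: "A *v x = (T (B *v x) - s) *s x"
    by (simp add: B_def matrix_vector_mult_add_rdistrib mat_mult_vec algebra_simps)
  have "x \<noteq> 0" using x(1) by (auto simp: S_def T_def)
  then have "positive_vec x"
    using nonneg_eigenvector_positive[OF assms eig] x(1) by (simp add: S_def)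
  then show ?thesis using eig that by blast
qed

lemma positive_vec_inner_pos:
  assumes "positive_vec v" "positive_vec w"
  shows "0 < v \<bullet> w"
  using assms unfolding inner_vec_def positive_vec_def by (auto intro!: sum_pos)

lemma perron_eigenvectors:
  fixes A :: "real^'n^'n"
  assumes "metzler A" "strongly_connected A"
  obtains v w l where "positive_vec v" "positive_vec w" "A *v v = l *s v" "w v* A = l *s w"
proof -
  obtain v l where v: "positive_vec v" "A *v v = l *s v"
    using perron_eigenvector_exists[OF assms] by blast
  \<comment> \<open>A left eigenvector is a right eigenvector of the transpose, which inherits both
    hypotheses.\<close>
  obtain w m where w: "positive_vec w" "w v* A = m *s w"
    using perron_eigenvector_exists[OF metzler_transpose[OF assms(1)]
        strongly_connected_transpose[OF assms(2)]] by (metis transpose_matrix_vector)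
  have "m * (w \<bullet> v) = (w v* A) \<bullet> v" using w by (simp add: scalar_mult_eq_scaleR)
  also have "\<dots> = l * (w \<bullet> v)" using v by (simp add: dot_lmul_matrix scalar_mult_eq_scaleR)
  finally have "m = l" using positive_vec_inner_pos[OF w(1) v(1)] by simp
  with v w show ?thesis using that by blast
qed

text \<open>Take the least multiple \<open>a *s v\<close> that dominates \<open>y\<close>. The
  difference is nonnegative, solves the same eigenvector equation and has a zero coordinate; if it
  were nonzero it would have to be positive.\<close>

lemma perron_eigenspace:
  fixes A :: "real^'n^'n"
  assumes "metzler A" "strongly_connected A"
    and v: "positive_vec v" "A *v v = l *s v" and y: "A *v y = l *s y"
  obtains a where "y = a *s v"
proof -
  define a where "a = Max (range (\<lambda>i. y $ i / v $ i))"
  have vpos: "0 < v $ i" for i using v by (simp add: positive_vec_def)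
  have "a \<in> range (\<lambda>i. y $ i / v $ i)" unfolding a_def by (rule Max_in) auto
  then obtain k where k: "a = y $ k / v $ k" by blast
  have le: "y $ i / v $ i \<le> a" for i unfolding a_def by (rule Max_ge) auto
  have "a *s v - y = 0"
  proof (rule ccontr)
    assume "a *s v - y \<noteq> 0"
    moreover have "A *v (a *s v - y) = l *s (a *s v - y)"
      using v y by (simp add: matrix_vector_mult_diff_distrib matrix_vector_mult_scaleR
          scalar_mult_eq_scaleR scaleR_diff_right)
    moreover have "0 \<le> (a *s v - y) $ i" for i
      using le[of i] vpos[of i] by (simp add: field_simps)
    ultimately have "positive_vec (a *s v - y)"
      using nonneg_eigenvector_positive[OF assms(1,2)] by blast
    then have "0 < (a *s v - y) $ k" unfolding positive_vec_def by blast
    then show False using k vpos[of k] by simp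
  qed
  then have "y = a *s v" by simp
  then show ?thesis by (rule that)
qed

text \<open>In the maximum norm weighted by \<open>v\<close>, the nonnegative matrix
  \<open>B = s I + A\<close> has norm at most \<open>l + s\<close>, because \<open>v\<close> is its
  eigenvector. So \<open>\<mu>\<close> lies in the disc of centre \<open>-s\<close> and radius
  \<open>l + s\<close>, which meets the half-plane of real parts at least \<open>l\<close> only in
  the point \<open>l\<close>.\<close>

lemma eigenvalue_Re_less:
  fixes A :: "real^'n^'n"
  assumes "metzler A" and v: "positive_vec v" "A *v v = l *s v"
    and \<mu>: "eigenvalue (complex_matrix A) \<mu>" "\<mu> \<noteq> of_real l"
  shows "Re \<mu> < l"
proof -
  obtain s where nn: "\<And>i j. 0 \<le> (mat s + A) $ i $ j"
    using metzler_shift_nonneg[OF assms(1)] by blast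
  obtain z where z: "z \<noteq> 0" "complex_matrix A *v z = \<mu> *s z"
    using \<mu>(1) unfolding eigenvalue_def by blast
  define B where "B = mat s + A"
  define m where "m = Max (range (\<lambda>i. cmod (z $ i) / v $ i))"
  have vpos: "0 < v $ i" for i using v by (simp add: positive_vec_def)
  have "m \<in> range (\<lambda>i. cmod (z $ i) / v $ i)" unfolding m_def by (rule Max_in) auto
  then obtain k where k: "m = cmod (z $ k) / v $ k" by blast
  have "cmod (z $ i) / v $ i \<le> m" for i unfolding m_def by (rule Max_ge) auto
  with vpos have le: "cmod (z $ i) \<le> m * v $ i" for i
    by (simp add: pos_divide_le_eq)
  obtain i0 where "z $ i0 \<noteq> 0" using z(1) by (auto simp: vec_eq_iff)
  then have "0 < m * v $ i0" using le[of i0] by (smt (verit) zero_less_norm_iff)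
  then have "0 < m" using vpos[of i0] by (simp add: zero_less_mult_iff)
  have Bz: "(\<Sum>j\<in>UNIV. of_real (B $ k $ j) * z $ j) = (\<mu> + of_real s) * z $ k"
  proof -
    have "(\<Sum>j\<in>UNIV. of_real (A $ k $ j) * z $ j) = \<mu> * z $ k"
      using arg_cong[OF z(2), of "\<lambda>v. v $ k"]
      by (simp add: matrix_vector_mult_def complex_matrix_def map_matrix_def)
    moreover have "(\<Sum>j\<in>UNIV. of_real (mat s $ k $ j) * z $ j) = of_real s * z $ k"
      by (subst sum.cong[OF refl, of UNIV _ "\<lambda>j. if k = j then of_real s * z $ j else 0"])
        (auto simp: mat_def)
    ultimately show ?thesis
      by (simp add: B_def algebra_simps sum.distrib)
  qed
  have Bv: "B *v v = (l + s) *s v"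
    using v by (simp add: B_def matrix_vector_mult_add_rdistrib mat_mult_vec algebra_simps)
  \<comment> \<open>Row \<open>k\<close> attains the weighted norm \<open>m\<close> of
    \<open>z\<close>, so \<open>cmod (z $ k)\<close> is exactly \<open>m * v $ k\<close>.\<close>
  have "cmod (\<mu> + of_real s) * (m * v $ k) = cmod (\<Sum>j\<in>UNIV. of_real (B $ k $ j) * z $ j)"
    using vpos[of k] by (simp add: Bz norm_mult k)
  also have "\<dots> \<le> (\<Sum>j\<in>UNIV. B $ k $ j * (m * v $ j))"
  proof (rule sum_norm_le)
    fix j
    have "0 \<le> B $ k $ j" using nn by (simp add: B_def)
    then show "cmod (of_real (B $ k $ j) * z $ j) \<le> B $ k $ j * (m * v $ j)"
      using le[of j] by (simp add: norm_mult mult_left_mono)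
  qed
  also have "\<dots> = m * (B *v v) $ k"
    by (simp add: matrix_vector_mult_def sum_distrib_left algebra_simps)
  also have "\<dots> = (l + s) * (m * v $ k)" by (simp add: Bv algebra_simps)
  finally have le_ls: "cmod (\<mu> + of_real s) \<le> l + s"
    using \<open>0 < m\<close> vpos[of k] by simp
  show ?thesis
  proof (rule ccontr)
    assume "\<not> Re \<mu> < l"
    with le_ls complex_Re_le_cmod[of "\<mu> + of_real s"]
    have "cmod (\<mu> + of_real s) = Re \<mu> + s" and Re: "Re \<mu> = l"
      by auto
    then have "Im \<mu> = 0"
      using cmod_power2[of "\<mu> + of_real s"] by simp
    with Re \<mu>(2) show False by (simp add: complex_eq_iff)
  qed
qed

section \<open>Algebraic simplicity of the eigenvalue\<close>

text \<open>The Leibniz expansion uses only sums, products and signs, which a ring homomorphism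
  preserves. The lemma is applied to evaluation of polynomials and to the embedding of the reals
  into the complex numbers.\<close>

lemma det_map_matrix:
  fixes h :: "'a::comm_ring_1 \<Rightarrow> 'b::comm_ring_1"
  assumes add: "\<And>x y. h (x + y) = h x + h y" and mult: "\<And>x y. h (x * y) = h x * h y"
    and one: "h 1 = 1"
  shows "det (map_matrix h M) = h (det M)"
proof -
  have zero: "h 0 = 0" using add[of 0 0] by simp
  have minus: "h (- x) = - h x" for x using add[of x "- x"] zero by (simp add: eq_neg_iff_add_eq_0 add.commute)
  have hsum: "h (sum f S) = (\<Sum>x\<in>S. h (f x))" if "finite S" for f and S :: "('n \<Rightarrow> 'n) set"
    using that by (induction S) (auto simp: zero add)
  have hprod: "h (prod f S) = (\<Prod>x\<in>S. h (f x))" if "finite S" for f and S :: "'n set"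
    using that by (induction S) (auto simp: one mult)
  have sgn: "h (of_int (sign p)) = of_int (sign p)" for p :: "'n \<Rightarrow> 'n"
    by (simp add: sign_def one minus)
  show ?thesis
    by (simp add: det_def hsum hprod mult sgn map_matrix_def finite_permutations)
qed

text \<open>Replacing column \<open>k\<close> of \<open>x I - M\<close> by \<open>(x I - M) v = (x - l) v\<close> multiplies the determinant
  by \<open>v $ k\<close>; hence the factor \<open>x - l\<close> splits off from the characteristic polynomial.\<close>

lemma algebraic_multiplicity_eq_1:
  fixes M :: "'a::field_char_0^'n^'n"
  assumes eig: "M *v v = l *s v" and vk: "v $ k \<noteq> 0"
    and nz: "det (\<chi> i j. if j = k then v $ i else (mat l - M) $ i $ j) \<noteq> 0"
  shows "algebraic_multiplicity M l = 1"
proof -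
  \<comment> \<open>\<open>N x\<close> is \<open>x I - M\<close> with column \<open>k\<close>
    replaced by \<open>v\<close>, and \<open>P\<close> is its polynomial version. The hypothesis
    \<open>nz\<close> concerns \<open>N l\<close>.\<close>
  define N where "N x = (\<chi> i j. if j = k then v $ i else (mat x - M) $ i $ j)" for x
  define P :: "'a poly^'n^'n"
    where "P = (\<chi> i j. if j = k then [:v $ i:] else (mat [:0, 1:] - map_matrix (\<lambda>a. [:a:]) M) $ i $ j)"
  have "poly (charpoly M) x = det (map_matrix (\<lambda>p. poly p x) (mat [:0, 1:] - map_matrix (\<lambda>a. [:a:]) M))" for x
    unfolding charpoly_def by (subst det_map_matrix[of "\<lambda>p. poly p x"]) auto
  moreover have "map_matrix (\<lambda>p. poly p x) (mat [:0, 1:] - map_matrix (\<lambda>a. [:a:]) M) = mat x - M" for x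
    by (simp add: vec_eq_iff map_matrix_def mat_def)
  ultimately have char: "poly (charpoly M) x = det (mat x - M)" for x by simp
  have "poly (det P) x = det (map_matrix (\<lambda>p. poly p x) P)" for x
    by (subst det_map_matrix[of "\<lambda>p. poly p x"]) auto
  moreover have "map_matrix (\<lambda>p. poly p x) P = N x" for x
    by (simp add: vec_eq_iff map_matrix_def mat_def P_def N_def)
  ultimately have P: "poly (det P) x = det (N x)" for x by simp
  have "v $ k * det (mat x - M) = (x - l) * det (N x)" for x
  proof -
    have col: "(mat x - M) *v v = (x - l) *s v"
      by (simp add: matrix_vector_mult_diff_rdistrib mat_mult_vec eig vec_eq_iff left_diff_distrib)
    \<comment> \<open>Cramer's lemma is used twice: for \<open>N x\<close>, whose column
      \<open>k\<close> is \<open>v\<close>, and for \<open>x I - M\<close> applied to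
      \<open>v\<close>. Both times column \<open>k\<close> becomes
      \<open>(x - l) *s v\<close>.\<close>
    have "N x *v axis k (x - l) = (x - l) *s v"
    proof -
      have "(\<Sum>j\<in>UNIV. N x $ i $ j * axis k (x - l) $ j) = (x - l) * v $ i" for i
        by (subst sum.cong[OF refl, of UNIV _ "\<lambda>j. if k = j then (x - l) * v $ i else 0"])
          (auto simp: N_def axis_def)
      then show ?thesis by (simp add: vec_eq_iff matrix_vector_mult_def left_diff_distrib)
    qed
    with cramer_lemma[of k "N x" "axis k (x - l)"]
    have "(x - l) * det (N x) = det (\<chi> i j. if j = k then ((x - l) *s v) $ i else N x $ i $ j)"
      by (simp only: axis_nth)
    also have "(\<chi> i j. if j = k then ((x - l) *s v) $ i else N x $ i $ j)
        = (\<chi> i j. if j = k then ((mat x - M) *v v) $ i else (mat x - M) $ i $ j)"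
      by (simp add: col vec_eq_iff N_def)
    also have "det \<dots> = v $ k * det (mat x - M)" by (rule cramer_lemma)
    finally show ?thesis by simp
  qed
  then have "poly (smult (v $ k) (charpoly M)) = poly ([:-l, 1:] * det P)"
    by (auto simp: fun_eq_iff char P algebra_simps)
  \<comment> \<open>Characteristic 0 makes the field infinite, so agreement at all points gives
    equality of polynomials.\<close>
  then have eq: "smult (v $ k) (charpoly M) = [:-l, 1:] * det P"
    by (simp only: poly_eq_poly_eq_iff)
  have root: "poly (det P) l \<noteq> 0" using nz by (simp add: P N_def)
  then have "det P \<noteq> 0" by auto
  have "order l (charpoly M) = order l (smult (v $ k) (charpoly M))"
    using vk by (simp add: order_smult)
  also have "\<dots> = order l ([:-l, 1:] ^ 1) + order l (det P)"
    unfolding eq power_one_right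
    by (rule order_mult) (use \<open>det P \<noteq> 0\<close> in \<open>simp only: mult_eq_0_iff, simp\<close>)
  also have "\<dots> = 1" by (simp only: order_power_n_n order_0I[OF root] add_0_right)
  finally show ?thesis by (simp add: algebraic_multiplicity_def)
qed

text \<open>If \<open>z\<close> is in the kernel, let \<open>y\<close> be \<open>z\<close> with
  coordinate \<open>k\<close> erased; then \<open>z $ k *s v + (l I - A) y = 0\<close>. Pairing with
  \<open>w\<close> kills the second term, so \<open>z $ k = 0\<close>. Now \<open>y\<close> lies in
  the eigenspace spanned by \<open>v\<close> and vanishes at \<open>k\<close>, hence is
  zero.\<close>

lemma perron_det_nonzero:
  fixes A :: "real^'n^'n"
  assumes "metzler A" "strongly_connected A"
    and v: "positive_vec v" "A *v v = l *s v" and w: "positive_vec w" "w v* A = l *s w"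
  shows "det (\<chi> i j. if j = k then v $ i else (mat l - A) $ i $ j) \<noteq> 0"
proof -
  define N where "N = (\<chi> i j. if j = k then v $ i else (mat l - A) $ i $ j)"
  have "z = 0" if "N *v z = 0" for z
  proof -
    define y where "y = z - axis k (z $ k)"
    have "N *v z = z $ k *s v + (mat l - A) *v y"
    proof -
      have "(\<Sum>j\<in>UNIV. N $ i $ j * z $ j)
          = (\<Sum>j\<in>UNIV. (if k = j then z $ k * v $ i else 0) + (mat l - A) $ i $ j * y $ j)" for i
        by (rule sum.cong) (auto simp: N_def y_def axis_def)
      then show ?thesis
        by (simp add: vec_eq_iff matrix_vector_mult_def sum.distrib)
    qed
    then have eq: "z $ k *s v + (l *s y - A *v y) = 0"
      using that by (simp add: matrix_vector_mult_diff_rdistrib mat_mult_vec)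
    have "w \<bullet> (A *v y) = l * (w \<bullet> y)"
      using w(2) by (metis dot_lmul_matrix inner_scaleR_left scalar_mult_eq_scaleR)
    then have "z $ k * (w \<bullet> v) = 0"
      using arg_cong[OF eq, of "\<lambda>x. w \<bullet> x"]
      by (simp add: inner_add_right inner_diff_right scalar_mult_eq_scaleR)
    then have zk: "z $ k = 0" using positive_vec_inner_pos[OF w(1) v(1)] by simp
    then have "A *v y = l *s y" using eq by simp
    then obtain a where a: "y = a *s v"
      using perron_eigenspace[OF assms(1,2) v] by blast
    have "y $ k = 0" by (simp add: y_def axis_def)
    then have "a = 0" using a v(1) by (auto simp: positive_vec_def less_le)
    then show "z = 0" using a zk by (simp add: y_def axis_def vec_eq_iff)
  qed
  then have "invertible N"
    by (metis invertible_left_inverse matrix_left_invertible_ker)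
  then show ?thesis by (simp add: invertible_det_nz N_def)
qed

lemma perron_is_frobenius_eigenvalue:
  fixes A :: "real^'n^'n"
  assumes "metzler A" "strongly_connected A"
    and v: "positive_vec v" "A *v v = l *s v" and w: "positive_vec w" "w v* A = l *s w"
  shows "is_frobenius_eigenvalue A l"
proof -
  define v' where "v' = (\<chi> i. complex_of_real (v $ i))"
  have vpos: "0 < v $ i" for i using v by (simp add: positive_vec_def)
  have eig: "complex_matrix A *v v' = of_real l *s v'"
  proof -
    have "(\<Sum>j\<in>UNIV. A $ i $ j * v $ j) = l * v $ i" for i
      using arg_cong[OF v(2), of "\<lambda>v. v $ i"] by (simp add: matrix_vector_mult_def)
    from arg_cong[OF this, of complex_of_real] show ?thesis
      by (simp add: vec_eq_iff matrix_vector_mult_def v'_def complex_matrix_def map_matrix_def)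
  qed
  \<comment> \<open>Any index will do, as all coordinates of \<open>v\<close> are positive.\<close>
  obtain k :: 'n where True by blast
  have v'k: "v' $ k \<noteq> 0" using vpos[of k] by (simp add: v'_def)
  have "(\<chi> i j. if j = k then v' $ i else (mat (of_real l) - complex_matrix A) $ i $ j)
      = map_matrix complex_of_real (\<chi> i j. if j = k then v $ i else (mat l - A) $ i $ j)"
    by (simp add: vec_eq_iff v'_def complex_matrix_def map_matrix_def mat_def)
  then have "det (\<chi> i j. if j = k then v' $ i else (mat (of_real l) - complex_matrix A) $ i $ j) \<noteq> 0"
    using perron_det_nonzero[OF assms, of k] by (simp add: det_map_matrix)
  then have "algebraic_multiplicity (complex_matrix A) (of_real l) = 1"
    using algebraic_multiplicity_eq_1[OF eig v'k] by blast
  moreover have "eigenvalue (complex_matrix A) (of_real l)"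
    unfolding eigenvalue_def using eig v'k by (metis zero_index)
  ultimately show ?thesis
    using eigenvalue_Re_less[OF assms(1) v] by (simp add: is_frobenius_eigenvalue_def)
qed

lemma frobenius_eigenvalue_eqI:
  assumes "is_frobenius_eigenvalue A l"
  shows "frobenius_eigenvalue A = l"
  unfolding frobenius_eigenvalue_def
proof (rule the_equality[of "is_frobenius_eigenvalue A", OF assms])
  fix m assume "is_frobenius_eigenvalue A m"
  \<comment> \<open>Two distinct candidates would each lie strictly below the other.\<close>
  with assms show "m = l"
    unfolding is_frobenius_eigenvalue_def
    by (metis Re_complex_of_real less_asym)
qed

section \<open>Linear differential equations\<close>

lemma has_vector_derivative_vecI:
  fixes f :: "real \<Rightarrow> real^'n"
  assumes "\<And>i. ((\<lambda>t. f t $ i) has_real_derivative f' $ i) (at t within S)"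
  shows "(f has_vector_derivative f') (at t within S)"
  unfolding has_vector_derivative_def
  by (subst has_derivative_componentwise_within)
    (use assms in \<open>auto simp: Basis_vec_def inner_axis has_field_derivative_def mult_commute_abs\<close>)

text \<open>This is the matrix exponential of \<open>t B\<close> applied to \<open>x0\<close>,
  written coordinatewise so that each coordinate is a real power series in \<open>t\<close>.\<close>

definition exp_flow :: "real^'n^'n \<Rightarrow> real^'n \<Rightarrow> real \<Rightarrow> real^'n" where
  "exp_flow B x0 t = (\<chi> i. \<Sum>n. (((*v) B ^^ n) x0 $ i / fact n) * t ^ n)"

text \<open>With \<open>K\<close> a bound for the operator norm of \<open>B\<close>, the terms are
  dominated by those of the series for \<open>norm x0 * exp (K * \<bar>t\<bar>)\<close>.\<close>

lemma summable_exp_flow: "summable (\<lambda>n. (((*v) B ^^ n) x0 $ i / fact n) * t ^ n)"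
  for B :: "real^'n^'n"
proof -
  obtain K where "0 \<le> K" and K: "\<And>x. norm (B *v x) \<le> norm x * K"
    using bounded_linear.nonneg_bounded[OF matrix_vector_mul_bounded_linear[of B]] by blast
  have iter: "norm (((*v) B ^^ n) x0) \<le> norm x0 * K ^ n" for n
  proof (induction n)
    case (Suc n)
    have "norm (((*v) B ^^ Suc n) x0) \<le> norm (((*v) B ^^ n) x0) * K" using K by simp
    also have "\<dots> \<le> (norm x0 * K ^ n) * K" using Suc \<open>0 \<le> K\<close> by (rule mult_right_mono)
    finally show ?case by (simp add: mult_ac)
  qed simp
  show ?thesis
  proof (rule summable_comparison_test')
    show "summable (\<lambda>n. norm x0 * (inverse (fact n) * (K * \<bar>t\<bar>) ^ n))"
      by (intro summable_mult summable_exp)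
    fix n :: nat
    have "\<bar>((*v) B ^^ n) x0 $ i\<bar> \<le> norm x0 * K ^ n"
      using component_le_norm_cart[of "((*v) B ^^ n) x0" i] iter[of n] by linarith
    then have "\<bar>((*v) B ^^ n) x0 $ i\<bar> * (inverse (fact n) * \<bar>t\<bar> ^ n)
        \<le> (norm x0 * K ^ n) * (inverse (fact n) * \<bar>t\<bar> ^ n)"
      by (rule mult_right_mono) simp
    then show "norm ((((*v) B ^^ n) x0 $ i / fact n) * t ^ n)
        \<le> norm x0 * (inverse (fact n) * (K * \<bar>t\<bar>) ^ n)"
      by (simp add: abs_mult power_abs power_mult_distrib divide_inverse mult_ac)
  qed
qed

lemma DERIV_exp_flow: "((\<lambda>t. exp_flow B x0 t $ i) has_real_derivative (B *v exp_flow B x0 t) $ i) (at t)"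
  for B :: "real^'n^'n"
proof -
  define a where "a j n = ((*v) B ^^ n) x0 $ j / fact n" for j n
  have summ: "summable (\<lambda>n. a j n * t ^ n)" for j t
    unfolding a_def by (rule summable_exp_flow)
  \<comment> \<open>The factor \<open>n + 1\<close> from differentiation cancels against the
    factorial, leaving one more application of \<open>B\<close>.\<close>
  have "diffs (a i) n = (B *v ((*v) B ^^ n) x0) $ i / fact n" for n
    by (simp add: diffs_def a_def del: of_nat_Suc)
  then have "diffs (a i) n = (\<Sum>j\<in>UNIV. B $ i $ j * a j n)" for n
    by (simp add: a_def matrix_vector_mult_def sum_divide_distrib)
  then have "(\<Sum>n. diffs (a i) n * t ^ n) = (\<Sum>n. \<Sum>j\<in>UNIV. B $ i $ j * (a j n * t ^ n))"
    by (simp add: sum_distrib_right mult.assoc)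
  also have "\<dots> = (\<Sum>j\<in>UNIV. \<Sum>n. B $ i $ j * (a j n * t ^ n))"
    by (intro suminf_sum summable_mult summ)
  also have "\<dots> = (B *v exp_flow B x0 t) $ i"
    by (simp add: matrix_vector_mult_def exp_flow_def suminf_mult[OF summ] flip: a_def)
  finally have "(\<Sum>n. diffs (a i) n * t ^ n) = (B *v exp_flow B x0 t) $ i" .
  moreover have "(\<lambda>t. exp_flow B x0 t $ i) = (\<lambda>t. \<Sum>n. a i n * t ^ n)"
    by (simp add: exp_flow_def a_def)
  ultimately show ?thesis
    using termdiffs_strong_converges_everywhere[OF summ, of i t] by simp
qed

text \<open>The equation is solved by \<open>exp (- s t)\<close> times the exponential series of \<open>s I + A\<close>, all of
  whose terms are nonnegative.\<close>

lemma metzler_nonneg_solution: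
  fixes A :: "real^'n^'n"
  assumes "metzler A" "positive_vec x0"
  shows "\<exists>x. is_solution A x0 x \<and> (\<forall>t\<ge>0. \<forall>i. 0 \<le> x t $ i)"
proof -
  obtain s where nn: "\<And>i j. 0 \<le> (mat s + A) $ i $ j"
    using metzler_shift_nonneg[OF assms(1)] by blast
  define B where "B = mat s + A"
  define x where "x t = exp (- s * t) *s exp_flow B x0 t" for t
  have iter: "0 \<le> ((*v) B ^^ n) x0 $ i" for n i
  proof (induction n arbitrary: i)
    case 0
    then show ?case using assms(2) by (simp add: positive_vec_def less_imp_le)
  next
    case (Suc n)
    then show ?case
      using nn by (simp add: matrix_vector_mult_def B_def sum_nonneg)
  qed
  have "0 \<le> x t $ i" if "0 \<le> t" for t i
  proof -
    have "0 \<le> exp_flow B x0 t $ i"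
      unfolding exp_flow_def vec_lambda_beta
      by (rule suminf_nonneg[OF summable_exp_flow]) (use iter that in auto)
    then show ?thesis by (simp add: x_def)
  qed
  moreover have "(x has_vector_derivative A *v x t) (at t within S)" for t S
  proof (rule has_vector_derivative_vecI)
    fix i
    \<comment> \<open>The term with \<open>s\<close> cancels the derivative of the factor
      \<open>exp (- s * t)\<close>.\<close>
    have "B *v exp_flow B x0 t = s *s exp_flow B x0 t + A *v exp_flow B x0 t"
      by (simp add: B_def matrix_vector_mult_add_rdistrib mat_mult_vec)
    then have "exp (- s * t) * (- s) * exp_flow B x0 t $ i + exp (- s * t) * (B *v exp_flow B x0 t) $ i
        = (A *v x t) $ i"
      by (simp add: x_def matrix_vector_mult_scaleR scalar_mult_eq_scaleR algebra_simps)
    moreover have "((\<lambda>t. x t $ i) has_real_derivative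
        exp (- s * t) * (- s) * exp_flow B x0 t $ i + exp (- s * t) * (B *v exp_flow B x0 t) $ i) (at t)"
      unfolding x_def
      by (auto intro!: derivative_eq_intros DERIV_exp_flow simp: algebra_simps)
    ultimately show "((\<lambda>t. x t $ i) has_real_derivative (A *v x t) $ i) (at t within S)"
      using has_field_derivative_at_within by metis
  qed
  moreover have "x 0 = x0"
  proof -
    \<comment> \<open>Since \<open>0 ^ 0 = 1\<close>, the constant term survives at time 0.\<close>
    have "(\<Sum>n. a n * 0 ^ n) = a 0" for a :: "nat \<Rightarrow> real" by (rule powser_zero)
    from this[of "\<lambda>n. ((*v) B ^^ n) x0 $ i / fact n" for i] show ?thesis
      by (simp add: x_def exp_flow_def vec_eq_iff)
  qed
  ultimately show ?thesis
    unfolding is_solution_def by blast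
qed

section \<open>Uniqueness and the conserved quantity\<close>

text \<open>A Gronwall argument: the squared norm of the difference, damped by
  \<open>exp (- 2 * K * \<tau>)\<close>, is nonincreasing, nonnegative and zero at time 0.\<close>

lemma solution_unique:
  fixes A :: "real^'n^'n"
  assumes x: "is_solution A x0 x" and y: "is_solution A x0 y" and "0 \<le> t"
  shows "x t = y t"
proof -
  obtain K where K: "\<And>v. norm (A *v v) \<le> norm v * K"
    using bounded_linear.nonneg_bounded[OF matrix_vector_mul_bounded_linear[of A]] by blast
  define z where "z \<tau> = x \<tau> - y \<tau>" for \<tau>
  define f where "f \<tau> = exp (- 2 * K * \<tau>) * (z \<tau> \<bullet> z \<tau>)" for \<tau>
  have dz: "(z has_vector_derivative A *v z \<tau>) (at \<tau> within {0..})" if "0 \<le> \<tau>" for \<tau>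
    using x y that unfolding z_def is_solution_def
    by (auto simp: matrix_vector_mult_diff_distrib intro!: has_vector_derivative_diff)
  have df: "(f has_real_derivative exp (- 2 * K * \<tau>) * (2 * (z \<tau> \<bullet> (A *v z \<tau>)) - 2 * K * (z \<tau> \<bullet> z \<tau>)))
      (at \<tau> within {0..})" if "0 \<le> \<tau>" for \<tau>
  proof -
    have "((\<lambda>\<tau>. z \<tau> \<bullet> z \<tau>) has_real_derivative 2 * (z \<tau> \<bullet> (A *v z \<tau>))) (at \<tau> within {0..})"
      using bounded_bilinear.has_vector_derivative[OF bounded_bilinear_inner dz[OF that] dz[OF that]]
      by (simp add: has_real_derivative_iff_has_vector_derivative inner_commute)
    then show ?thesis
      unfolding f_def by (auto intro!: derivative_eq_intros simp: algebra_simps)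
  qed
  have "f 0 \<ge> f t"
  proof (rule DERIV_nonpos_imp_decreasing_open[OF \<open>0 \<le> t\<close>])
    fix \<tau> :: real assume "0 < \<tau>" "\<tau> < t"
    have "z \<tau> \<bullet> (A *v z \<tau>) \<le> norm (z \<tau>) * norm (A *v z \<tau>)" by (rule norm_cauchy_schwarz)
    also have "\<dots> \<le> norm (z \<tau>) * (norm (z \<tau>) * K)" by (intro mult_left_mono K) simp
    finally have "z \<tau> \<bullet> (A *v z \<tau>) \<le> K * (z \<tau> \<bullet> z \<tau>)"
      by (simp add: dot_square_norm power2_eq_square mult_ac)
    then have "exp (- 2 * K * \<tau>) * (2 * (z \<tau> \<bullet> (A *v z \<tau>)) - 2 * K * (z \<tau> \<bullet> z \<tau>)) \<le> 0"
      by (intro mult_nonneg_nonpos) auto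
    \<comment> \<open>At interior times the derivative relative to the half-line is the ordinary
      one.\<close>
    moreover have "at \<tau> within {0..} = at \<tau>"
      using \<open>0 < \<tau>\<close> by (intro at_within_open_subset[of _ "{0<..}"]) auto
    ultimately show "\<exists>d. DERIV f \<tau> :> d \<and> d \<le> 0"
      using df[of \<tau>] \<open>0 < \<tau>\<close> by auto
  next
    have "continuous_on {0..} f"
      by (intro DERIV_continuous_on[OF df]) simp
    then show "continuous_on {0..t} f" by (rule continuous_on_subset) auto
  qed
  moreover have "f 0 = 0" using x y by (simp add: f_def z_def is_solution_def)
  ultimately have "z t \<bullet> z t \<le> 0" by (simp add: f_def mult_le_0_iff)
  then have "z t = 0" using inner_gt_zero_iff[of "z t"] by linarith
  then show ?thesis by (simp add: z_def)
qed

lemma trajectory_eq: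
  assumes "is_solution A x0 x" "0 \<le> t"
  shows "trajectory A x0 t = x t"
  unfolding trajectory_def using assms solution_unique by (intro the_equality) blast+

text \<open>Pairing with \<open>w\<close> reduces the system to the scalar equation with coefficient
  \<open>l\<close>, so \<open>exp (- l * t) * (w \<bullet> x t)\<close> is constant.\<close>

lemma left_eigenvector_solution:
  fixes A :: "real^'n^'n"
  assumes w: "w v* A = l *s w" and x: "is_solution A x0 x" and "0 \<le> t"
  shows "w \<bullet> x t = exp (l * t) * (w \<bullet> x0)"
proof -
  define g where "g \<tau> = exp (- l * \<tau>) * (w \<bullet> x \<tau>)" for \<tau>
  have "(g has_real_derivative 0) (at \<tau> within {0..})" if "\<tau> \<in> {0..}" for \<tau>
  proof -
    have "((\<lambda>\<tau>. w \<bullet> x \<tau>) has_real_derivative w \<bullet> (A *v x \<tau>)) (at \<tau> within {0..})"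
      unfolding has_real_derivative_iff_has_vector_derivative
      by (rule bounded_linear.has_vector_derivative[OF bounded_linear_inner_right])
        (use x that in \<open>simp add: is_solution_def\<close>)
    moreover have "w \<bullet> (A *v x \<tau>) = l * (w \<bullet> x \<tau>)"
      using w by (metis dot_lmul_matrix inner_scaleR_left scalar_mult_eq_scaleR)
    ultimately show ?thesis
      unfolding g_def by (auto intro!: derivative_eq_intros simp: algebra_simps)
  qed
  then obtain a where "\<And>\<tau>. \<tau> \<in> {0..} \<Longrightarrow> g \<tau> = a"
    using has_field_derivative_zero_constant[of "{0..}" g] by auto
  then have "g t = g 0" using \<open>0 \<le> t\<close> by simp
  then have "exp (- l * t) * (w \<bullet> x t) = w \<bullet> x0"
    using x by (simp add: g_def is_solution_def)
  then show ?thesis by (simp add: exp_minus field_simps)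
qed

section \<open>The logarithmic rate\<close>

lemma system_output_bounds:
  fixes A :: "real^'n^'n"
  assumes "metzler A" "positive_vec c" "positive_vec x0"
    and w: "positive_vec w" "w v* A = l *s w"
  obtains m M where "0 < m" "0 < M"
    "\<And>t. 0 \<le> t \<Longrightarrow> m * exp (l * t) \<le> system_output A c x0 t"
    "\<And>t. 0 \<le> t \<Longrightarrow> system_output A c x0 t \<le> M * exp (l * t)"
proof -
  obtain x where x: "is_solution A x0 x" and nonneg: "\<And>t i. 0 \<le> t \<Longrightarrow> 0 \<le> x t $ i"
    using metzler_nonneg_solution[OF assms(1,3)] by blast
  have cpos: "0 < c $ i" and wpos: "0 < w $ i" for i
    using assms by (auto simp: positive_vec_def)
  have wx0: "0 < w \<bullet> x0" using w(1) assms(3) by (rule positive_vec_inner_pos)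
  \<comment> \<open>The extreme ratios bracket \<open>c\<close> coordinatewise between multiples of
    \<open>w\<close>; pairing with the nonnegative \<open>x t\<close> preserves the
    inequalities.\<close>
  define R where "R = range (\<lambda>i. c $ i / w $ i)"
  have R: "finite R" "R \<noteq> {}" "\<And>r. r \<in> R \<Longrightarrow> 0 < r"
    using cpos wpos by (auto simp: R_def)
  then have pos: "0 < Min R" "0 < Max R" by auto
  have "Min R \<le> c $ i / w $ i" "c $ i / w $ i \<le> Max R" for i
    using R by (auto simp: R_def)
  with wpos have cw: "Min R * w $ i \<le> c $ i" "c $ i \<le> Max R * w $ i" for i
    by (simp_all add: pos_divide_le_eq pos_le_divide_eq)
  have out: "system_output A c x0 t = c \<bullet> x t" if "0 \<le> t" for t
    using trajectory_eq[OF x that] by (simp add: system_output_def)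
  show ?thesis
  proof (rule that)
    show "0 < Min R * (w \<bullet> x0)" "0 < Max R * (w \<bullet> x0)" using pos wx0 by auto
    fix t :: real assume t: "0 \<le> t"
    have "Min R * (w \<bullet> x t) \<le> c \<bullet> x t" "c \<bullet> x t \<le> Max R * (w \<bullet> x t)"
      using cw nonneg[OF t] unfolding inner_vec_def sum_distrib_left
      by (auto intro!: sum_mono mult_right_mono simp flip: mult.assoc)
    then show "Min R * (w \<bullet> x0) * exp (l * t) \<le> system_output A c x0 t"
      "system_output A c x0 t \<le> Max R * (w \<bullet> x0) * exp (l * t)"
      by (simp_all add: out[OF t] left_eigenvector_solution[OF w(2) x t] mult_ac)
  qed
qed

text \<open>After taking logarithms and dividing by \<open>t\<close>, the constants contribute only
  \<open>ln m / t\<close> and \<open>ln M / t\<close>, which vanish. The upper limit is thus a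
  genuine limit.\<close>

lemma log_rate_exp_bounds:
  assumes "0 < m" "0 < M"
    and lower: "\<And>t. 0 \<le> t \<Longrightarrow> m * exp (l * t) \<le> system_output A c x0 t"
    and upper: "\<And>t. 0 \<le> t \<Longrightarrow> system_output A c x0 t \<le> M * exp (l * t)"
  shows "log_rate A c x0 = ereal l"
proof -
  define y where "y = system_output A c x0"
  have ypos: "0 < y t" if "0 \<le> t" for t
    using lower[OF that] assms(1) unfolding y_def by (smt (verit) exp_gt_zero mult_pos_pos)
  have "((\<lambda>t. ln (y t) / t) \<longlongrightarrow> l) at_top"
  proof (rule tendsto_sandwich)
    have const: "((\<lambda>t. ln a / t + l) \<longlongrightarrow> l) at_top" for a :: real
      using tendsto_add[OF tendsto_divide_0[OF tendsto_const
          filterlim_at_top_imp_at_infinity[OF filterlim_ident]] tendsto_const] by force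
    show "((\<lambda>t. ln m / t + l) \<longlongrightarrow> l) at_top" "((\<lambda>t. ln M / t + l) \<longlongrightarrow> l) at_top"
      by (rule const)+
    show "\<forall>\<^sub>F t in at_top. ln m / t + l \<le> ln (y t) / t"
      using eventually_gt_at_top[of 0]
    proof eventually_elim
      case (elim t)
      have "ln (m * exp (l * t)) \<le> ln (y t)"
        using lower[of t] ypos[of t] elim assms(1) by (simp add: y_def)
      then have "(ln m + l * t) / t \<le> ln (y t) / t"
        using elim assms(1) by (intro divide_right_mono) (simp_all add: ln_mult)
      then show ?case using elim by (simp add: add_divide_distrib)
    qed
    show "\<forall>\<^sub>F t in at_top. ln (y t) / t \<le> ln M / t + l"
      using eventually_gt_at_top[of 0]
    proof eventually_elim
      case (elim t)
      have "ln (y t) \<le> ln (M * exp (l * t))"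
        using upper[of t] ypos[of t] elim assms(2) by (simp add: y_def)
      then have "ln (y t) / t \<le> (ln M + l * t) / t"
        using elim assms(2) by (intro divide_right_mono) (simp_all add: ln_mult)
      then show ?case using elim by (simp add: add_divide_distrib)
    qed
  qed
  then have "((\<lambda>t. ereal (ln (y t) / t)) \<longlongrightarrow> ereal l) at_top" by simp
  \<comment> \<open>The output is positive, so the value minus infinity of \<open>ln_abs\<close>
    never occurs here.\<close>
  moreover have "\<forall>\<^sub>F t in at_top. ereal (ln (y t) / t) = ereal (1 / t) * ln_abs (y t)"
    using eventually_gt_at_top[of 0]
  proof eventually_elim
    case (elim t)
    then show ?case using ypos[of t] by (simp add: ln_abs_def)
  qed
  ultimately have "((\<lambda>t. ereal (1 / t) * ln_abs (y t)) \<longlongrightarrow> ereal l) at_top"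
    by (rule Lim_transform_eventually)
  then show ?thesis
    unfolding log_rate_def y_def by (intro lim_imp_Limsup) auto
qed

lemma log_rate_eq_frobenius_eigenvalue:
  fixes A :: "real^'n^'n"
  assumes "irreducible_metzler A" "positive_vec c" "positive_vec x0"
  shows "log_rate A c x0 = ereal (frobenius_eigenvalue A)"
proof -
  have A: "metzler A" "strongly_connected A"
    using assms(1) irreducible_metzler_strongly_connected
    by (auto simp: irreducible_metzler_def)
  obtain v w l where v: "positive_vec v" "A *v v = l *s v" and w: "positive_vec w" "w v* A = l *s w"
    using perron_eigenvectors[OF A] by blast
  have "frobenius_eigenvalue A = l"
    by (rule frobenius_eigenvalue_eqI[OF perron_is_frobenius_eigenvalue[OF A v w]])
  moreover have "log_rate A c x0 = ereal l"
    using system_output_bounds[OF A(1) assms(2,3) w] log_rate_exp_bounds by metis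
  ultimately show ?thesis by simp
qed

theorem theorem1:
  fixes U :: "'p::euclidean_space set"
    and A :: "'p \<Rightarrow> real^'n^'n"
    and c :: "real^'n"
  assumes "convex U"
    and "\<And>u. u \<in> U \<Longrightarrow> irreducible_metzler (A u)"
    and "positive_vec c"
  shows "(\<forall>u\<in>U. \<forall>x0. positive_vec x0 \<longrightarrow>
             log_rate (A u) c x0 = ereal (frobenius_eigenvalue (A u))) \<and>
         (\<forall>u\<in>U. \<forall>x0 x1. positive_vec x0 \<and> positive_vec x1 \<longrightarrow>
             log_rate (A u) c x0 = log_rate (A u) c x1) \<and>
         (\<forall>u\<in>U. common_log_rate (A u) c = ereal (frobenius_eigenvalue (A u)))"
proof -
  have rate: "log_rate (A u) c x0 = ereal (frobenius_eigenvalue (A u))"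
    if "u \<in> U" "positive_vec x0" for u x0
    using log_rate_eq_frobenius_eigenvalue assms that by blast
  \<comment> \<open>Uniqueness of the common value requires at least one positive initial state;
    \<open>c\<close> itself is one.\<close>
  moreover have "common_log_rate (A u) c = ereal (frobenius_eigenvalue (A u))" if "u \<in> U" for u
    unfolding common_log_rate_def using rate[OF that] assms(3) by (intro the_equality) auto
  ultimately show ?thesis by simp
qed

end
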